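(* Let $G$ be a graph and $n$ a positive integer. If there exists a covering array $CA(n,G,2)$, then there exists a covering array $CA(n,G,2)$ in which every row has exactly $\lfloor n/2\rfloor$ entries equal to $0$. Moreover, if $n$ is even, then there exists such a covering array in which, in addition, every row begins with $0$.
   Context: Graphs are finite and simple. Two vectors $u,v\in\{0,1\}^n$ are qualitatively independent if for every ordered pair $(a,b)\in\{0,1\}^2$ there is an index $i$ with $(u_i,v_i)=(a,b)$. A covering array $CA(n,G,2)$ is a $|V(G)|\times n$ array with entries from $\{0,1\}$ whose rows correspond to the vertices of $G$, such that any two rows corresponding to adjacent vertices are qualitatively independent. *)

theory Defs
  imports "Graph_Theory.Digraph"
begin

text \<open>
  A vector in \<open>{0,1}^n\<close> is a function on \<open>nat\<close> of which only the values at the indices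
  \<open>0, \<dots>, n - 1\<close> matter. An array is a function from row labels to vectors.
\<close>

definition binary_vector :: "nat \<Rightarrow> (nat \<Rightarrow> nat) \<Rightarrow> bool" where
  "binary_vector n u \<longleftrightarrow> (\<forall>i<n. u i \<in> {0, 1})"

definition qualitatively_independent :: "nat \<Rightarrow> (nat \<Rightarrow> nat) \<Rightarrow> (nat \<Rightarrow> nat) \<Rightarrow> bool" where
  "qualitatively_independent n u v \<longleftrightarrow>
     (\<forall>a\<in>{0, 1}. \<forall>b\<in>{0, 1}. \<exists>i<n. u i = a \<and> v i = b)"

text \<open>
  Finite simple graphs are given by the locale \<open>graph\<close>: an undirected edge is a pair of
  opposite arcs, so \<open>u \<rightarrow>\<^bsub>G\<^esub> v\<close> is adjacency. The entries of \<open>A\<close> outside \<open>verts G\<close> and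
  beyond index \<open>n - 1\<close> are unconstrained.
\<close>

definition covering_array :: "nat \<Rightarrow> ('v, 'e) pre_digraph \<Rightarrow> ('v \<Rightarrow> nat \<Rightarrow> nat) \<Rightarrow> bool" where
  "covering_array n G A \<longleftrightarrow>
     (\<forall>v\<in>verts G. binary_vector n (A v)) \<and>
     (\<forall>u\<in>verts G. \<forall>v\<in>verts G. u \<rightarrow>\<^bsub>G\<^esub> v \<longrightarrow> qualitatively_independent n (A u) (A v))"

end

theory Submission
  imports Defs
begin

text \<open>
  Identify a row with the set \<open>S \<subseteq> {..<n}\<close> of its zero positions. Two rows are qualitatively
  independent iff their sets \<^emph>\<open>cross\<close>: they meet, neither contains the other, and they do not
  cover \<open>{..<n}\<close>. So it suffices to find a map on subsets of \<open>{..<n}\<close> that preserves crossing and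
  has only sets of size \<open>n div 2\<close> as values; it is then applied to every row.

  Crossing is unchanged when a set is replaced by its complement, so all sets may be taken of size
  at most \<open>n div 2\<close>. These are enlarged along the chains of an injective matching, which sends
  each set \<open>S\<close> with \<open>2 * card S < n\<close> to a superset with one more element
  (\<open>upward_matching\<close>). Let \<open>S\<close> and \<open>T\<close> cross and be
  enlarged to \<open>S'\<close> and \<open>T'\<close> of size \<open>n div 2\<close>. The enlarged sets still meet, and having a common
  point they are too small to cover \<open>{..<n}\<close>. If one contained the other they would be equal; but
  by injectivity two sets end at the same place only if one lies on the chain started by the other,
  hence is a superset of it, which crossing excludes.

  The matching comes from lattice paths. Read \<open>S\<close> as a path that goes up at each
  \<open>i \<in> S\<close> and down at each other \<open>i < n\<close>. If \<open>2 * card S < n\<close>, the path ends below its start, so the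
  step into its \<^emph>\<open>first\<close> minimum is a down step; turn it into an up step. In the new path this step
  leaves the \<^emph>\<open>last\<close> minimum, so it can be located and undone.

  For even \<open>n\<close>, complementation also preserves the size \<open>n div 2\<close>, and the sets without \<open>0\<close> can be
  complemented once more.
\<close>

section \<open>An injective matching between levels of the Boolean lattice\<close>

definition path_height :: "nat set \<Rightarrow> nat \<Rightarrow> int" where
  "path_height S i = (\<Sum>j<i. if j \<in> S then 1 else - 1)"

definition is_last_min :: "nat \<Rightarrow> nat set \<Rightarrow> nat \<Rightarrow> bool" where
  "is_last_min n S i \<longleftrightarrow> i \<le> n \<and> (\<forall>k\<le>n. path_height S i \<le> path_height S k) \<and>
     (\<forall>k\<le>n. i < k \<longrightarrow> path_height S i < path_height S k)"

lemma is_last_min_unique: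
  assumes "is_last_min n S i" "is_last_min n S j"
  shows "i = j"
  using assms unfolding is_last_min_def by (metis linorder_neqE_nat not_less)

lemma path_height_Suc:
  "path_height S (Suc i) = path_height S i + (if i \<in> S then 1 else - 1)"
  by (simp add: path_height_def)

lemma path_height_end:
  assumes "S \<subseteq> {..<n}"
  shows "path_height S n = 2 * int (card S) - int n"
proof -
  have "path_height S n = (\<Sum>j<n. 2 * (if j \<in> S then 1 else 0) - 1)"
    unfolding path_height_def by (rule sum.cong) auto
  also have "\<dots> = 2 * (\<Sum>j<n. if j \<in> S then 1 else 0) - int n"
    by (simp add: sum_subtractf sum_distrib_left)
  also have "(\<Sum>j<n. if j \<in> S then 1 else 0) = int (card ({..<n} \<inter> S))"
    by (simp add: sum.If_cases)
  also have "{..<n} \<inter> S = S"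
    using assms by auto
  finally show ?thesis .
qed

lemma path_height_insert:
  assumes "j \<notin> S"
  shows "path_height (insert j S) i = path_height S i + (if j < i then 2 else 0)"
  using assms by (induction i) (auto simp: path_height_def less_Suc_eq)

text \<open>
  The witness \<open>j\<close> is the step into the first minimum: every earlier point of the path is strictly
  higher, and turning the step upwards raises every later point by 2, so its starting point becomes
  the last minimum.
\<close>

lemma flip_to_last_min:
  assumes "S \<subseteq> {..<n}" "2 * card S < n"
  obtains j where "j < n" "j \<notin> S" "is_last_min n (insert j S) j"
proof -
  let ?min = "\<lambda>i. i \<le> n \<and> (\<forall>k\<le>n. path_height S i \<le> path_height S k)"
  define p where "p = (LEAST i. ?min i)"
  have "\<exists>i. ?min i"
    using ex_is_arg_min_if_finite[of "{..n}" "path_height S"]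
    by (auto simp: is_arg_min_linorder)
  then have p_min: "?min p"
    unfolding p_def by (rule LeastI_ex)
  have p_first: "path_height S p < path_height S i" if "i < p" for i
  proof -
    have "\<not> ?min i"
      using not_less_Least that unfolding p_def by blast
    moreover have "i \<le> n"
      using that p_min by simp
    ultimately obtain k where k: "k \<le> n" "path_height S k < path_height S i"
      by (auto simp: not_le)
    have "path_height S p \<le> path_height S k"
      using p_min k(1) by blast
    then show ?thesis
      using k(2) by simp
  qed
  have "path_height S n < path_height S 0"
    using path_height_end[OF assms(1)] assms(2) by (simp add: path_height_def)
  then have "p \<noteq> 0"
    using p_min by (metis le_refl not_less)
  then obtain j where j: "p = Suc j"
    using not0_implies_Suc by blast
  have "path_height S (Suc j) < path_height S j"
    using p_first[of j] j by simp
  then have "j \<notin> S" and step: "path_height S j = path_height S p + 1"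
    unfolding j by (auto simp: path_height_Suc split: if_splits)
  have "is_last_min n (insert j S) j"
    unfolding is_last_min_def
  proof (intro conjI allI impI)
    show "j \<le> n"
      using p_min j by simp
  next
    fix k assume "k \<le> n"
    then have "path_height S p \<le> path_height S k"
      using p_min by blast
    moreover have "path_height S p < path_height S k" if "k \<le> j"
      using p_first that j by simp
    ultimately show "path_height (insert j S) j \<le> path_height (insert j S) k"
      using step by (auto simp: path_height_insert[OF \<open>j \<notin> S\<close>] not_less)
  next
    fix k assume "k \<le> n" "j < k"
    then have "path_height S p \<le> path_height S k"
      using p_min by blast
    then show "path_height (insert j S) j < path_height (insert j S) k"
      using step \<open>j < k\<close> by (simp add: path_height_insert[OF \<open>j \<notin> S\<close>])
  qed
  then show thesis
    using that[of j] \<open>j \<notin> S\<close> p_min j by simp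
qed

lemma upward_matching:
  obtains f :: "nat set \<Rightarrow> nat set" where
    "\<And>S. S \<subseteq> {..<n} \<Longrightarrow> 2 * card S < n \<Longrightarrow>
       S \<subseteq> f S \<and> f S \<subseteq> {..<n} \<and> card (f S) = Suc (card S)"
    "inj_on f {S. S \<subseteq> {..<n} \<and> 2 * card S < n}"
proof -
  let ?L = "{S. S \<subseteq> {..<n} \<and> 2 * card S < n}"
  have "\<forall>S\<in>?L. \<exists>j. j < n \<and> j \<notin> S \<and> is_last_min n (insert j S) j"
    by (auto elim: flip_to_last_min)
  from bchoice[OF this] obtain pos where
    "\<forall>S\<in>?L. pos S < n \<and> pos S \<notin> S \<and> is_last_min n (insert (pos S) S) (pos S)" ..
  then have pos: "pos S < n \<and> pos S \<notin> S \<and> is_last_min n (insert (pos S) S) (pos S)"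
    if "S \<in> ?L" for S
    using that by blast
  show thesis
  proof (rule that[of "\<lambda>S. insert (pos S) S"])
    fix S assume S: "S \<subseteq> {..<n}" "2 * card S < n"
    then show "S \<subseteq> insert (pos S) S \<and> insert (pos S) S \<subseteq> {..<n} \<and>
        card (insert (pos S) S) = Suc (card S)"
      using pos[of S] finite_subset[OF S(1)] by auto
  next
    show "inj_on (\<lambda>S. insert (pos S) S) ?L"
    proof (rule inj_onI)
      fix S T assume S: "S \<in> ?L" and T: "T \<in> ?L"
        and eq: "insert (pos S) S = insert (pos T) T"
      have "pos S = pos T"
        using pos[OF S] pos[OF T] eq is_last_min_unique by metis
      then show "S = T"
        using pos[OF S] pos[OF T] eq by (metis insert_ident)
    qed
  qed
qed

section \<open>Enlarging sets to the middle level\<close>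

text \<open>
  Stepping the matching up to the middle level merges two sets only if one of
  them lies on the chain started by the other; therefore the fibres consist of comparable sets.
\<close>

lemma middle_level_map:
  obtains g :: "nat set \<Rightarrow> nat set" where
    "\<And>S. S \<subseteq> {..<n} \<Longrightarrow> card S \<le> n div 2 \<Longrightarrow>
       S \<subseteq> g S \<and> g S \<subseteq> {..<n} \<and> card (g S) = n div 2"
    "\<And>S T. S \<subseteq> {..<n} \<Longrightarrow> card S \<le> n div 2 \<Longrightarrow> T \<subseteq> {..<n} \<Longrightarrow> card T \<le> n div 2 \<Longrightarrow>
       g S = g T \<Longrightarrow> S \<subseteq> T \<or> T \<subseteq> S"
proof -
  obtain f :: "nat set \<Rightarrow> nat set" where
    f: "\<And>S. S \<subseteq> {..<n} \<Longrightarrow> 2 * card S < n \<Longrightarrow>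
       S \<subseteq> f S \<and> f S \<subseteq> {..<n} \<and> card (f S) = Suc (card S)" and
    inj: "inj_on f {S. S \<subseteq> {..<n} \<and> 2 * card S < n}"
    using upward_matching[of n] by blast
  have iter: "S \<subseteq> (f ^^ a) S \<and> (f ^^ a) S \<subseteq> {..<n} \<and> card ((f ^^ a) S) = card S + a"
    if "S \<subseteq> {..<n}" "card S + a \<le> n div 2" for S a
    using that(2)
  proof (induction a)
    case 0
    then show ?case using that(1) by simp
  next
    case (Suc a)
    then have IH: "S \<subseteq> (f ^^ a) S" "(f ^^ a) S \<subseteq> {..<n}" "card ((f ^^ a) S) = card S + a"
      by auto
    moreover from this have "2 * card ((f ^^ a) S) < n"
      using Suc.prems by linarith
    ultimately show ?case
      using f[of "(f ^^ a) S"] by auto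
  qed
  have merge: "S \<subseteq> T"
    if "S \<subseteq> {..<n}" "T \<subseteq> {..<n}" "card S + (d + b) \<le> n div 2" "card T + b \<le> n div 2"
      "(f ^^ (d + b)) S = (f ^^ b) T" for S T d b
    using that(3-)
  proof (induction b)
    case 0
    then show ?case using iter[OF that(1), of d] by simp
  next
    case (Suc b)
    have S: "(f ^^ (d + b)) S \<subseteq> {..<n}" "2 * card ((f ^^ (d + b)) S) < n"
      using iter[OF that(1), of "d + b"] Suc.prems(1) by auto
    have T: "(f ^^ b) T \<subseteq> {..<n}" "2 * card ((f ^^ b) T) < n"
      using iter[OF that(2), of b] Suc.prems(2) by auto
    have "f ((f ^^ (d + b)) S) = f ((f ^^ b) T)"
      using Suc.prems(3) by simp
    then have "(f ^^ (d + b)) S = (f ^^ b) T"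
      using inj_onD[OF inj] S T by blast
    then show ?case
      using Suc by simp
  qed
  define g where "g = (\<lambda>S. (f ^^ (n div 2 - card S)) S)"
  have comparable: "S \<subseteq> T" if "S \<subseteq> {..<n}" "T \<subseteq> {..<n}" "card T \<le> n div 2" "g S = g T"
    "card S \<le> card T" for S T
    using merge[of S T "card T - card S" "n div 2 - card T"] that by (simp add: g_def)
  show thesis
  proof (rule that[of g])
    fix S assume "S \<subseteq> {..<n}" "card S \<le> n div 2"
    then show "S \<subseteq> g S \<and> g S \<subseteq> {..<n} \<and> card (g S) = n div 2"
      using iter[of S "n div 2 - card S"] by (simp add: g_def)
  next
    fix S T
    assume "S \<subseteq> {..<n}" "card S \<le> n div 2" "T \<subseteq> {..<n}" "card T \<le> n div 2" "g S = g T"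
    then show "S \<subseteq> T \<or> T \<subseteq> S"
      using comparable[of S T] comparable[of T S] nat_le_linear by metis
  qed
qed

section \<open>Crossing sets\<close>

definition crossing :: "nat \<Rightarrow> nat set \<Rightarrow> nat set \<Rightarrow> bool" where
  "crossing n S T \<longleftrightarrow> S \<inter> T \<noteq> {} \<and> \<not> S \<subseteq> T \<and> \<not> T \<subseteq> S \<and> S \<union> T \<noteq> {..<n}"

lemma crossing_commute: "crossing n S T \<longleftrightarrow> crossing n T S"
  unfolding crossing_def by blast

lemma crossing_complement:
  assumes "S \<subseteq> {..<n}" "T \<subseteq> {..<n}" "crossing n S T"
  shows "crossing n ({..<n} - S) T"
  using assms unfolding crossing_def by blast

lemma crossing_complement_if:
  assumes "S \<subseteq> {..<n}" "T \<subseteq> {..<n}" "crossing n S T"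
  shows "crossing n (if P then S else {..<n} - S) (if Q then T else {..<n} - T)"
proof -
  let ?S = "if P then S else {..<n} - S"
  have S: "crossing n T ?S"
    using assms crossing_complement crossing_commute by (cases P) auto
  have "?S \<subseteq> {..<n}"
    using assms(1) by auto
  then show ?thesis
    using S assms(2) crossing_complement[of T n ?S] by (cases Q) (simp_all add: crossing_commute)
qed

lemma crossing_preserving_middle_map:
  obtains \<phi> :: "nat set \<Rightarrow> nat set" where
    "\<And>S. S \<subseteq> {..<n} \<Longrightarrow> \<phi> S \<subseteq> {..<n} \<and> card (\<phi> S) = n div 2"
    "\<And>S T. S \<subseteq> {..<n} \<Longrightarrow> T \<subseteq> {..<n} \<Longrightarrow> crossing n S T \<Longrightarrow> crossing n (\<phi> S) (\<phi> T)"
proof -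
  obtain g :: "nat set \<Rightarrow> nat set" where
    g: "\<And>S. S \<subseteq> {..<n} \<Longrightarrow> card S \<le> n div 2 \<Longrightarrow>
       S \<subseteq> g S \<and> g S \<subseteq> {..<n} \<and> card (g S) = n div 2" and
    comparable: "\<And>S T. S \<subseteq> {..<n} \<Longrightarrow> card S \<le> n div 2 \<Longrightarrow> T \<subseteq> {..<n} \<Longrightarrow>
       card T \<le> n div 2 \<Longrightarrow> g S = g T \<Longrightarrow> S \<subseteq> T \<or> T \<subseteq> S"
    using middle_level_map[of n] by blast
  define small where "small = (\<lambda>S. if card S \<le> n div 2 then S else {..<n} - S)"
  have small: "small S \<subseteq> {..<n}" "card (small S) \<le> n div 2" if "S \<subseteq> {..<n}" for S
    using that by (auto simp: small_def card_Diff_subset finite_subset)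
  have g_crossing: "crossing n (g S) (g T)"
    if S: "S \<subseteq> {..<n}" "card S \<le> n div 2" and T: "T \<subseteq> {..<n}" "card T \<le> n div 2"
      and ST: "crossing n S T" for S T
  proof -
    have fin: "finite (g S)" "finite (g T)"
      using g[OF S] g[OF T] finite_subset by blast+
    have "g S \<noteq> g T"
      using comparable[OF S T] ST unfolding crossing_def by blast
    \<comment> \<open>Distinct sets of equal size are incomparable.\<close>
    then have "\<not> g S \<subseteq> g T" "\<not> g T \<subseteq> g S"
      using card_subset_eq[OF fin(2), of "g S"] card_subset_eq[OF fin(1), of "g T"]
        g[OF S] g[OF T] by auto
    moreover have meet: "g S \<inter> g T \<noteq> {}"
      using ST g[OF S] g[OF T] unfolding crossing_def by blast
    moreover have "g S \<union> g T \<noteq> {..<n}"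
    proof
      assume "g S \<union> g T = {..<n}"
      then have "card (g S) + card (g T) = n + card (g S \<inter> g T)"
        using card_Un_Int[OF fin] by simp
      moreover have "card (g S \<inter> g T) > 0"
        using meet fin by (simp add: card_gt_0_iff)
      ultimately show False
        using g[OF S] g[OF T] by simp
    qed
    ultimately show ?thesis
      unfolding crossing_def by blast
  qed
  show thesis
  proof (rule that[of "\<lambda>S. g (small S)"])
    fix S assume "S \<subseteq> {..<n}"
    then show "g (small S) \<subseteq> {..<n} \<and> card (g (small S)) = n div 2"
      using g small by blast
  next
    fix S T assume ST: "S \<subseteq> {..<n}" "T \<subseteq> {..<n}" "crossing n S T"
    then have "crossing n (small S) (small T)"
      unfolding small_def by (rule crossing_complement_if)
    then show "crossing n (g (small S)) (g (small T))"
      using g_crossing small ST(1,2) by blast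
  qed
qed

section \<open>Rows as sets of zero positions\<close>

definition zeros :: "nat \<Rightarrow> (nat \<Rightarrow> nat) \<Rightarrow> nat set" where
  "zeros n u = {i. i < n \<and> u i = 0}"

definition row_of :: "nat set \<Rightarrow> nat \<Rightarrow> nat" where
  "row_of S i = (if i \<in> S then 0 else 1)"

lemma binary_row_of: "binary_vector n (row_of S)"
  by (simp add: binary_vector_def row_of_def)

lemma zeros_subset: "zeros n u \<subseteq> {..<n}"
  by (auto simp: zeros_def)

lemma zeros_row_of: "S \<subseteq> {..<n} \<Longrightarrow> zeros n (row_of S) = S"
  by (auto simp: zeros_def row_of_def)

lemma qualitatively_independent_iff_crossing:
  assumes "binary_vector n u" "binary_vector n v"
  shows "qualitatively_independent n u v \<longleftrightarrow> crossing n (zeros n u) (zeros n v)"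
proof -
  have bin: "u i = 1 \<longleftrightarrow> u i \<noteq> 0" "v i = 1 \<longleftrightarrow> v i \<noteq> 0" if "i < n" for i
    using assms that unfolding binary_vector_def by auto
  have "qualitatively_independent n u v \<longleftrightarrow>
      (\<exists>i<n. u i = 0 \<and> v i = 0) \<and> (\<exists>i<n. u i = 0 \<and> v i = 1) \<and>
      (\<exists>i<n. u i = 1 \<and> v i = 0) \<and> (\<exists>i<n. u i = 1 \<and> v i = 1)"
    unfolding qualitatively_independent_def by auto
  also have "\<dots> \<longleftrightarrow>
      (\<exists>i<n. u i = 0 \<and> v i = 0) \<and> (\<exists>i<n. u i = 0 \<and> v i \<noteq> 0) \<and>
      (\<exists>i<n. u i \<noteq> 0 \<and> v i = 0) \<and> (\<exists>i<n. u i \<noteq> 0 \<and> v i \<noteq> 0)"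
    using bin by (simp cong: conj_cong)
  also have "(\<exists>i<n. u i = 0 \<and> v i = 0) \<longleftrightarrow> zeros n u \<inter> zeros n v \<noteq> {}"
    by (auto simp: zeros_def)
  also have "(\<exists>i<n. u i = 0 \<and> v i \<noteq> 0) \<longleftrightarrow> \<not> zeros n u \<subseteq> zeros n v"
    by (auto simp: zeros_def)
  also have "(\<exists>i<n. u i \<noteq> 0 \<and> v i = 0) \<longleftrightarrow> \<not> zeros n v \<subseteq> zeros n u"
    by (auto simp: zeros_def)
  also have "(\<exists>i<n. u i \<noteq> 0 \<and> v i \<noteq> 0) \<longleftrightarrow> \<not> {..<n} \<subseteq> zeros n u \<union> zeros n v"
    by (auto simp: zeros_def)
  also have "\<dots> \<longleftrightarrow> zeros n u \<union> zeros n v \<noteq> {..<n}"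
    using zeros_subset by blast
  finally show ?thesis
    unfolding crossing_def .
qed

lemma covering_array_map:
  assumes "covering_array n G A"
    and sub: "\<And>S. S \<subseteq> {..<n} \<Longrightarrow> \<phi> S \<subseteq> {..<n}"
    and cross: "\<And>S T. S \<subseteq> {..<n} \<Longrightarrow> T \<subseteq> {..<n} \<Longrightarrow> crossing n S T \<Longrightarrow> crossing n (\<phi> S) (\<phi> T)"
  shows "covering_array n G (\<lambda>v. row_of (\<phi> (zeros n (A v))))"
  unfolding covering_array_def
proof (intro conjI ballI impI)
  fix u v assume "u \<in> verts G" "v \<in> verts G" "u \<rightarrow>\<^bsub>G\<^esub> v"
  then have "crossing n (zeros n (A u)) (zeros n (A v))"
    using assms(1) qualitatively_independent_iff_crossing unfolding covering_array_def by blast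
  then have "crossing n (\<phi> (zeros n (A u))) (\<phi> (zeros n (A v)))"
    by (intro cross zeros_subset)
  then show "qualitatively_independent n (row_of (\<phi> (zeros n (A u)))) (row_of (\<phi> (zeros n (A v))))"
    by (simp add: qualitatively_independent_iff_crossing binary_row_of zeros_row_of sub zeros_subset)
qed (rule binary_row_of)

theorem theorem5p3p8:
  fixes G :: "('v, 'e) pre_digraph" and n :: nat
  assumes "graph G"
    and "n > 0"
    and "\<exists>A. covering_array n G A"
  shows "(\<exists>A. covering_array n G A \<and>
            (\<forall>v\<in>verts G. card {i. i < n \<and> A v i = 0} = n div 2)) \<and>
         (even n \<longrightarrow>
           (\<exists>A. covering_array n G A \<and>
             (\<forall>v\<in>verts G. card {i. i < n \<and> A v i = 0} = n div 2) \<and>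
             (\<forall>v\<in>verts G. A v 0 = 0)))"
proof -
  obtain A where A: "covering_array n G A"
    using assms(3) by blast
  obtain \<phi> :: "nat set \<Rightarrow> nat set" where
    \<phi>: "\<And>S. S \<subseteq> {..<n} \<Longrightarrow> \<phi> S \<subseteq> {..<n} \<and> card (\<phi> S) = n div 2" and
    cross: "\<And>S T. S \<subseteq> {..<n} \<Longrightarrow> T \<subseteq> {..<n} \<Longrightarrow> crossing n S T \<Longrightarrow> crossing n (\<phi> S) (\<phi> T)"
    using crossing_preserving_middle_map[of n] by blast
  define \<psi> where "\<psi> = (\<lambda>S. if 0 \<in> \<phi> S then \<phi> S else {..<n} - \<phi> S)"
  have \<psi>_sub: "\<psi> S \<subseteq> {..<n}" if "S \<subseteq> {..<n}" for S
    using \<phi>[OF that] by (auto simp: \<psi>_def)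
  have \<psi>_cross: "crossing n (\<psi> S) (\<psi> T)"
    if "S \<subseteq> {..<n}" "T \<subseteq> {..<n}" "crossing n S T" for S T
    unfolding \<psi>_def using \<phi>[OF that(1)] \<phi>[OF that(2)] cross[OF that]
    by (intro crossing_complement_if) auto
  have \<psi>_card: "card (\<psi> S) = n div 2" if "S \<subseteq> {..<n}" "even n" for S
    using \<phi>[OF that(1)] that(2) by (auto simp: \<psi>_def card_Diff_subset finite_subset)
  have \<psi>_zero: "0 \<in> \<psi> S" for S
    using assms(2) by (simp add: \<psi>_def)
  let ?B = "\<lambda>v. row_of (\<phi> (zeros n (A v)))" and ?C = "\<lambda>v. row_of (\<psi> (zeros n (A v)))"
  have "covering_array n G ?B"
    using A \<phi> cross by (intro covering_array_map) auto
  moreover have "card {i. i < n \<and> ?B v i = 0} = n div 2" for v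
    using \<phi>[OF zeros_subset] zeros_row_of unfolding zeros_def[of n "row_of _", symmetric] by simp
  moreover have "covering_array n G ?C"
    using A \<psi>_sub \<psi>_cross by (rule covering_array_map)
  moreover have "card {i. i < n \<and> ?C v i = 0} = n div 2" if "even n" for v
    using \<psi>_card[OF zeros_subset that] zeros_row_of[OF \<psi>_sub[OF zeros_subset]]
    unfolding zeros_def[of n "row_of _", symmetric] by simp
  moreover have "?C v 0 = 0" for v
    using \<psi>_zero by (simp add: row_of_def)
  ultimately show ?thesis
    by blast
qed

end
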